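(* Let $T$ be a tree in which every nontrivial pseudo-supremum is a supremum, with the interval topology. The following are equivalent: (1) $T$ is hereditarily paracompact; (2) $T$ is paracompact and has no uncountable branches; (3) $T$ is the topological direct sum of countable compact spaces, each homeomorphic to an ordinal (with the order topology); (4) $T$ is metrizable.
   Context: A tree is a partially ordered set in which the set of predecessors of each element is well-ordered. For a nonempty chain bounded above, its pseudo-supremum is the set of its minimal upper bounds; standing assumption: each such set is a singleton. A branch is a maximal chain. The interval topology has as base all sets $(s,t]=\{x:s<x\le t\}$ together with all singletons $\{t\}$ with $t$ minimal. *)

theory Defs
  imports "HOL-Analysis.Analysis"
begin

text \<open>A tree is a subset T of a partially ordered type; its order is the restriction of the
  ambient order. \<close>

definition is_chain_in :: "'a::order set \<Rightarrow> 'a set \<Rightarrow> bool" where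
  "is_chain_in T C \<longleftrightarrow> C \<subseteq> T \<and> (\<forall>x\<in>C. \<forall>y\<in>C. x \<le> y \<or> y \<le> x)"

definition well_ordered_set :: "'a::order set \<Rightarrow> bool" where
  "well_ordered_set S \<longleftrightarrow> (\<forall>x\<in>S. \<forall>y\<in>S. x \<le> y \<or> y \<le> x) \<and>
     (\<forall>A. A \<subseteq> S \<and> A \<noteq> {} \<longrightarrow> (\<exists>m\<in>A. \<forall>a\<in>A. m \<le> a))"

definition preds :: "'a::order set \<Rightarrow> 'a \<Rightarrow> 'a set" where
  "preds T t = {s \<in> T. s < t}"

definition is_tree :: "'a::order set \<Rightarrow> bool" where
  "is_tree T \<longleftrightarrow> (\<forall>t\<in>T. well_ordered_set (preds T t))"

definition upper_bounds_in :: "'a::order set \<Rightarrow> 'a set \<Rightarrow> 'a set" where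
  "upper_bounds_in T C = {u \<in> T. \<forall>c\<in>C. c \<le> u}"

definition pseudo_sup :: "'a::order set \<Rightarrow> 'a set \<Rightarrow> 'a set" where
  "pseudo_sup T C = {u \<in> upper_bounds_in T C. \<forall>v\<in>upper_bounds_in T C. \<not> v < u}"

text \<open>Standing assumption: every nonempty chain bounded above has exactly one minimal upper bound.\<close>
definition psup_singleton :: "'a::order set \<Rightarrow> bool" where
  "psup_singleton T \<longleftrightarrow> (\<forall>C. is_chain_in T C \<and> C \<noteq> {} \<and> upper_bounds_in T C \<noteq> {}
       \<longrightarrow> (\<exists>s. pseudo_sup T C = {s}))"

definition nontrivial_psups_are_sups :: "'a::order set \<Rightarrow> bool" where
  "nontrivial_psups_are_sups T \<longleftrightarrow> (\<forall>C s. is_chain_in T C \<and> C \<noteq> {} \<and> \<not> (\<exists>m\<in>C. \<forall>c\<in>C. c \<le> m)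
       \<and> s \<in> pseudo_sup T C \<longrightarrow> (\<forall>u\<in>upper_bounds_in T C. s \<le> u))"

definition is_branch :: "'a::order set \<Rightarrow> 'a set \<Rightarrow> bool" where
  "is_branch T B \<longleftrightarrow> is_chain_in T B \<and> (\<forall>C. is_chain_in T C \<and> B \<subseteq> C \<longrightarrow> C = B)"

definition interval_topology :: "'a::order set \<Rightarrow> 'a topology" where
  "interval_topology T = topology_generated_by
     ({{x \<in> T. s < x \<and> x \<le> t} | s t. s \<in> T \<and> t \<in> T} \<union>
      {{t} | t. t \<in> T \<and> \<not> (\<exists>s\<in>T. s < t)})"

definition paracompact_space :: "'a topology \<Rightarrow> bool" where
  "paracompact_space X \<longleftrightarrow> (\<forall>\<U>. (\<forall>U\<in>\<U>. openin X U) \<and> \<Union>\<U> = topspace X \<longrightarrow>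
     (\<exists>\<V>. (\<forall>V\<in>\<V>. openin X V) \<and> \<Union>\<V> = topspace X \<and> (\<forall>V\<in>\<V>. \<exists>U\<in>\<U>. V \<subseteq> U)
          \<and> locally_finite_in X \<V>))"

definition hereditarily_paracompact :: "'a topology \<Rightarrow> bool" where
  "hereditarily_paracompact X \<longleftrightarrow> (\<forall>S. S \<subseteq> topspace X \<longrightarrow> paracompact_space (subtopology X S))"

definition wo_order_topology :: "('b \<times> 'b) set \<Rightarrow> 'b topology" where
  "wo_order_topology r = topology_generated_by
     ({Field r} \<union> {{x. x \<noteq> a \<and> (x, a) \<in> r} | a. a \<in> Field r}
                \<union> {{x. x \<noteq> a \<and> (a, x) \<in> r} | a. a \<in> Field r})"

definition homeomorphic_to_ordinal :: "'b topology \<Rightarrow> bool" where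
  "homeomorphic_to_ordinal X \<longleftrightarrow> (\<exists>r :: ('b \<times> 'b) set. Well_order r \<and>
      X homeomorphic_space (wo_order_topology r))"

definition top_direct_sum_of :: "'a topology \<Rightarrow> 'a set set \<Rightarrow> bool" where
  "top_direct_sum_of X P \<longleftrightarrow> \<Union>P = topspace X \<and> (\<forall>A\<in>P. openin X A) \<and>
     (\<forall>A\<in>P. \<forall>B\<in>P. A \<noteq> B \<longrightarrow> A \<inter> B = {})"

end

theory Submission
  imports Defs
begin

text \<open>(1) implies (2): an uncountable branch contains a copy of the first uncountable ordinal, which is
  countably compact but not compact, hence not paracompact. (2) implies (3): all sets
  $\{x \mid x \le t\}$ are compact, clopen and countable, so a locally finite open refinement of the cover
  by these sets splits the tree into countable clopen pieces; each piece is enumerated as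
  $t_0, t_1, \ldots$ and disjointified into the compact chains
  $\{x \mid x \le t_n\}$ minus all $\{x \mid x \le t_j\}$ with $j < n$. (3) implies (4):
  a countable compact piece embeds into a countable power of the two-point space. (4) implies (1) is
  Stone's theorem.\<close>

section \<open>Paracompactness and metrizability\<close>

text \<open>The sets of all x \<le> t are open and compact in every tree; that nontrivial
  pseudo-suprema are suprema enters through one fact only, the closedness of these sets. Closedness
  is what survives the disjointification: the final pieces are closed subsets of compact chains, and
  it also makes the separating family of each piece clopen. Countability of the pieces in (2)
  implies (3) draws on both halves of (2). Countable branches make each set of all x \<le> t
  countable, and local finiteness puts each point in only finitely many members of the refinement,
  so chaining overlapping members together cannot reach uncountably many points.\<close>

text \<open>M. E. Rudin's proof of Stone's theorem.\<close>

theorem (in Metric_space) paracompact_space_mtopology: "paracompact_space mtopology"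
  unfolding paracompact_space_def
proof (intro allI impI, elim conjE)
  fix \<U> assume op: "\<forall>U\<in>\<U>. openin mtopology U" and cov: "\<Union>\<U> = topspace mtopology"
  obtain r :: "'a set rel" where r: "well_order_on UNIV r"
    using well_order_on by metis
  have wf_r: "wf (r - Id)" and anti: "antisym r" and tot_refl: "total_on UNIV r" "refl_on UNIV r"
    using r unfolding order_on_defs by blast+
  then have tot: "(U, V) \<in> r \<or> (V, U) \<in> r" for U V
    by (cases "U = V") (simp_all add: total_on_def refl_on_def)
  \<comment> \<open>Each point is charged to the first member of the cover containing it, in a fixed
    well-order of all subsets; \<open>a x\<close> will name this member.\<close>
  have "\<exists>U\<in>\<U>. x \<in> U \<and> (\<forall>V\<in>\<U>. x \<in> V \<longrightarrow> (U, V) \<in> r)" if "x \<in> M" for x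
  proof -
    have "x \<in> \<Union>\<U>" using cov that by simp
    then obtain U0 where "U0 \<in> {U \<in> \<U>. x \<in> U}" by blast
    then obtain U where U: "U \<in> \<U>" "x \<in> U"
       "\<And>V. (V, U) \<in> r - Id \<Longrightarrow> V \<notin> {U \<in> \<U>. x \<in> U}"
      by (rule wfE_min[OF wf_r]) blast
    then have "(U, V) \<in> r" if "V \<in> \<U>" "x \<in> V" for V
      using tot[of U V] that by (cases "U = V") auto
    then show ?thesis using U by blast
  qed
  then obtain a where a: "\<And>x. x \<in> M \<Longrightarrow> a x \<in> \<U> \<and> x \<in> a x"
      and least: "\<And>x V. x \<in> M \<Longrightarrow> V \<in> \<U> \<Longrightarrow> x \<in> V \<Longrightarrow> (a x, V) \<in> r"
    by metis
  \<comment> \<open>Radii halve from level to level, so two radii of level \<open>Suc j\<close> add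
    up to one of level \<open>j\<close>.\<close>
  define e :: "nat \<Rightarrow> real" where "e = (\<lambda>n. (1/2)^n)"
  have e_pos: "e n > 0" and e_Suc: "e n = 2 * e (Suc n)" for n by (auto simp: e_def)
  have e_mono: "e m \<le> e n" if "n \<le> m" for m n
    using that by (simp add: e_def power_decreasing)
  have e_small: "\<exists>n. e n < \<epsilon>" if "\<epsilon> > 0" for \<epsilon>
    using real_arch_pow_inv[OF that, of "1/2"] by (auto simp: e_def)
  \<comment> \<open>Of the three radii, two are spent on the balls around two centres; the third
    leaves a gap of \<open>e n\<close> between sets of level \<open>n\<close> charged to different
    members.\<close>
  define S where "S n = {x \<in> M. mball x (3 * e n) \<subseteq> a x}" for n
  \<comment> \<open>\<open>F n\<close> is everything covered at levels below \<open>n\<close>. The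
    recursion carries only this set; the sets \<open>D n U\<close> are read off from it
    afterwards.\<close>
  define F where "F = rec_nat {} (\<lambda>n F. F \<union> (\<Union>x\<in>S n - F. mball x (e n)))"
  have F_Suc: "F (Suc n) = F n \<union> (\<Union>x\<in>S n - F n. mball x (e n))" for n
    by (simp add: F_def)
  have F_0: "F 0 = {}" by (simp add: F_def)
  have F_mono: "F m \<subseteq> F n" if "m \<le> n" for m n
    using that by (rule lift_Suc_mono_le[rotated]) (auto simp: F_Suc)
  define D where "D n U = (\<Union>x\<in>{x \<in> S n - F n. a x = U}. mball x (e n))" for n U
  have D_open: "openin mtopology (D n U)" for n U
    unfolding D_def by blast
  have D_sub: "D n U \<subseteq> U" for n U
  proof -
    have "mball x (e n) \<subseteq> a x" if "x \<in> S n" for x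
      using that mball_subset_concentric[of "e n" "3 * e n" x] e_pos[of n] by (auto simp: S_def)
    then show ?thesis by (auto simp: D_def)
  qed
  have F_D: "\<exists>k<n. \<exists>U\<in>\<U>. x \<in> D k U" if "x \<in> F n" for x n
    using that
  proof (induction n)
    case 0 then show ?case by (simp add: F_0)
  next
    case (Suc n)
    show ?case
    proof (cases "x \<in> F n")
      case True then show ?thesis using Suc.IH less_Suc_eq by blast
    next
      case False
      then obtain y where "y \<in> S n - F n" "x \<in> mball y (e n)" using Suc.prems F_Suc by auto
      then have "x \<in> D n (a y)" "a y \<in> \<U>" using a by (auto simp: D_def S_def)
      then show ?thesis by blast
    qed
  qed
  have D_F: "D n U \<subseteq> F (Suc n)" for n U by (auto simp: D_def F_Suc)
  have covD: "\<exists>n. \<exists>U\<in>\<U>. x \<in> D n U" if "x \<in> M" for x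
  proof -
    have "openin mtopology (a x)" "x \<in> a x" using a[OF that] op by auto
    then obtain \<epsilon> where "\<epsilon> > 0" "mball x \<epsilon> \<subseteq> a x" using openin_mtopology by blast
    moreover obtain n where "e n < \<epsilon>/3" using e_small[of "\<epsilon>/3"] \<open>\<epsilon> > 0\<close> by auto
    ultimately have xS: "x \<in> S n"
      using that mball_subset_concentric[of "3 * e n" \<epsilon> x] by (auto simp: S_def)
    have "x \<in> F (Suc n)" using xS that e_pos[of n] by (auto simp: F_Suc)
    then show ?thesis using F_D by blast
  qed
  have sep: "d y z \<ge> 3 * e n" if "y \<in> S n" "z \<in> S n" "a y \<noteq> a z" for y z n
  proof -
    \<comment> \<open>If \<open>z\<close> were within three radii of \<open>y\<close> it would lie
      in \<open>a y\<close>, so \<open>a z\<close> would come no later than \<open>a y\<close>; as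
      \<open>a y\<close> comes no later than \<open>a z\<close>, the two would coincide.\<close>
    have *: "d y z \<ge> 3 * e n" if "y \<in> S n" "z \<in> S n" "a y \<noteq> a z" "(a y, a z) \<in> r" for y z
    proof (rule ccontr)
      assume "\<not> ?thesis"
      then have "z \<in> mball y (3 * e n)" using that by (auto simp: S_def)
      then have "z \<in> a y" using that by (auto simp: S_def)
      then have "(a z, a y) \<in> r" using least[of z "a y"] a[of y] that by (auto simp: S_def)
      then show False using that anti by (auto dest: antisymD)
    qed
    show ?thesis using *[of y z] *[of z y] that tot[of "a y" "a z"] commute[of y z] by auto
  qed
  define \<V> where "\<V> = (\<lambda>(n, U). D n U) ` (UNIV \<times> \<U>)"
  have "locally_finite_in mtopology \<V>"
    unfolding locally_finite_in_def
  proof (intro conjI ballI)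
    show "\<Union> \<V> \<subseteq> topspace mtopology"
      using D_open openin_subset by (fastforce simp: \<V>_def)
  next
    fix x assume "x \<in> topspace mtopology"
    then have xM: "x \<in> M" by simp
    then obtain n U where xD: "U \<in> \<U>" "x \<in> D n U" using covD by blast
    then obtain \<epsilon> where "\<epsilon> > 0" "mball x \<epsilon> \<subseteq> D n U" 
      using openin_mtopology D_open by metis
    moreover obtain j where "e j < \<epsilon>" using e_small \<open>\<epsilon> > 0\<close> by blast
    ultimately have j: "mball x (e j) \<subseteq> D n U" 
      using mball_subset_concentric[of "e j" \<epsilon> x] by auto
    \<comment> \<open>\<open>N > n\<close> forces centres of level at least \<open>N\<close> to
      avoid \<open>D n U\<close>, which is covered by then; \<open>N > j\<close> makes the two radii
      in \<open>far\<close> at most half of \<open>e j\<close>.\<close>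
    define N where "N = Suc (n + j)"
    have far: "D i W \<inter> mball x (e N) = {}" if "i \<ge> N" for i W
    proof (rule ccontr)
      assume "\<not> ?thesis"
      then obtain p y where p: "p \<in> mball x (e N)" "p \<in> mball y (e i)" "y \<in> S i" "y \<notin> F i"
        unfolding D_def by blast
      have "F (Suc n) \<subseteq> F i" using that by (intro F_mono) (auto simp: N_def)
      then have "y \<notin> mball x (e j)" using p D_F[of n U] j by blast
      then have "d x y \<ge> e j" using p xM by auto
      moreover have "d x y \<le> d x p + d p y" using p by (auto intro: triangle)
      moreover have "d x p < e N" "d p y < e i" using p by (auto simp: commute)
      moreover have "e i \<le> e (Suc j)" "e N \<le> e (Suc j)" using that by (auto intro!: e_mono simp: N_def)
      ultimately show False using e_Suc[of j] by linarith
    qed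
    \<comment> \<open>The two centres would be closer than \<open>2 * e i + 2 * e N\<close>, which
      is at most \<open>3 * e i\<close> because \<open>i < N\<close>; this contradicts
      \<open>sep\<close>.\<close>
    have near: "W = W'" if meet: "D i W \<inter> mball x (e N) \<noteq> {}" "D i W' \<inter> mball x (e N) \<noteq> {}" and "i < N" for i W W'
    proof (rule ccontr)
      assume "W \<noteq> W'"
      obtain p y where p: "p \<in> mball x (e N)" "p \<in> mball y (e i)" "y \<in> S i" "a y = W"
        using meet unfolding D_def by blast
      obtain q z where q: "q \<in> mball x (e N)" "q \<in> mball z (e i)" "z \<in> S i" "a z = W'"
        using meet unfolding D_def by blast
      have "3 * e i \<le> d y z" using sep p q \<open>W \<noteq> W'\<close> by blast
      moreover have "d y z \<le> d y p + d p x + d x q + d q z"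
        using p q triangle[of y p z] triangle[of p x z] triangle[of x q z] by fastforce
      moreover have "d y p < e i" "d p x < e N" "d x q < e N" "d q z < e i"
        using p q by (auto simp: commute)
      moreover have "e N \<le> e (Suc i)" using \<open>i < N\<close> by (intro e_mono) auto
      ultimately show False using e_Suc[of i] by linarith
    qed
    \<comment> \<open>Each level below \<open>N\<close> contributes at most one set meeting the
      ball, so \<open>SOME\<close> recovers its index and the levels alone enumerate all such
      sets.\<close>
    have "{V \<in> \<V>. V \<inter> mball x (e N) \<noteq> {}} 
          \<subseteq> (\<lambda>i. D i (SOME W. D i W \<inter> mball x (e N) \<noteq> {})) ` {..<N}"
    proof
      fix V assume "V \<in> {V \<in> \<V>. V \<inter> mball x (e N) \<noteq> {}}"
      then obtain i W where V: "V = D i W" "D i W \<inter> mball x (e N) \<noteq> {}" by (auto simp: \<V>_def)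
      then have "i < N" using far not_le by blast
      moreover have "(SOME W. D i W \<inter> mball x (e N) \<noteq> {}) = W"
        using near[OF someI[of "\<lambda>W. D i W \<inter> mball x (e N) \<noteq> {}", OF V(2)] V(2) \<open>i < N\<close>] .
      ultimately show "V \<in> (\<lambda>i. D i (SOME W. D i W \<inter> mball x (e N) \<noteq> {})) ` {..<N}"
        using V by blast
    qed
    then have "finite {V \<in> \<V>. V \<inter> mball x (e N) \<noteq> {}}" by (rule finite_subset) auto
    then show "\<exists>V. openin mtopology V \<and> x \<in> V \<and> finite {U \<in> \<V>. U \<inter> V \<noteq> {}}"
      using xM e_pos[of N] by (intro exI[of _ "mball x (e N)"]) auto
  qed
  moreover have "\<Union>\<V> = topspace mtopology"
    using covD D_open openin_subset by (fastforce simp: \<V>_def)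
  moreover have "\<forall>V\<in>\<V>. openin mtopology V"
    using D_open by (auto simp: \<V>_def)
  moreover have "\<forall>V\<in>\<V>. \<exists>U\<in>\<U>. V \<subseteq> U"
    unfolding \<V>_def by clarsimp (use D_sub in blast)
  ultimately show "\<exists>\<V>. (\<forall>V\<in>\<V>. openin mtopology V) \<and> \<Union>\<V> = topspace mtopology \<and>
      (\<forall>V\<in>\<V>. \<exists>U\<in>\<U>. V \<subseteq> U) \<and> locally_finite_in mtopology \<V>"
    by blast
qed

corollary metrizable_imp_paracompact_space: "metrizable_space X \<Longrightarrow> paracompact_space X"
  using Metric_space.paracompact_space_mtopology by (auto simp: metrizable_space_def)

corollary metrizable_imp_hereditarily_paracompact:
  "metrizable_space X \<Longrightarrow> hereditarily_paracompact X"
  by (simp add: hereditarily_paracompact_def metrizable_imp_paracompact_space metrizable_space_subtopology)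

section \<open>Countable open partitions and criteria for metrizability\<close>

lemma paracompact_space_refinement:
  assumes "paracompact_space X" "\<And>U. U \<in> \<U> \<Longrightarrow> openin X U" "\<Union>\<U> = topspace X"
  obtains \<V> where "\<forall>V\<in>\<V>. openin X V" "\<Union>\<V> = topspace X" "\<forall>V\<in>\<V>. \<exists>U\<in>\<U>. V \<subseteq> U"
    "locally_finite_in X \<V>"
proof -
  have "\<exists>\<V>. (\<forall>V\<in>\<V>. openin X V) \<and> \<Union>\<V> = topspace X \<and> (\<forall>V\<in>\<V>. \<exists>U\<in>\<U>. V \<subseteq> U) \<and> locally_finite_in X \<V>"
    using assms by (simp add: paracompact_space_def)
  then show thesis using that by (elim exE conjE)
qed

text \<open>The classes of the transitive closure of ``lying in a common member of a point-countable cover by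
  countable open sets'' are countable and open.\<close>
lemma countable_open_partition:
  assumes op: "\<And>V. V \<in> \<V> \<Longrightarrow> openin X V" and cov: "\<Union>\<V> = topspace X"
    and cnt: "\<And>V. V \<in> \<V> \<Longrightarrow> countable V"
    and pt: "\<And>x. x \<in> topspace X \<Longrightarrow> countable {V \<in> \<V>. x \<in> V}"
  obtains P where "top_direct_sum_of X P" "\<And>K. K \<in> P \<Longrightarrow> countable K"
proof -
  define R where "R = {(x, y). \<exists>V\<in>\<V>. x \<in> V \<and> y \<in> V}"
  define P where "P = (\<lambda>x. R\<^sup>* `` {x}) ` topspace X"
  have symR: "sym (R\<^sup>*)" by (rule sym_rtrancl) (auto simp: sym_def R_def)
  have "R\<^sup>* `` {x} \<subseteq> topspace X" if "x \<in> topspace X" for x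
  proof
    fix y assume "y \<in> R\<^sup>* `` {x}"
    then have "(x, y) \<in> R\<^sup>*" by simp
    then show "y \<in> topspace X" by (cases rule: rtranclE) (use that cov in \<open>auto simp: R_def\<close>)
  qed
  then have "\<Union>P = topspace X" by (force simp: P_def)
  moreover have "openin X (R\<^sup>* `` {x})" if x: "x \<in> topspace X" for x
  proof (subst openin_subopen, intro ballI)
    fix y assume y: "y \<in> R\<^sup>* `` {x}"
    then have "y \<in> topspace X" using \<open>\<Union>P = topspace X\<close> x by (auto simp: P_def)
    then obtain V where V: "V \<in> \<V>" "y \<in> V" using cov by blast
    have "V \<subseteq> R\<^sup>* `` {x}"
    proof
      fix z assume "z \<in> V"
      then have "(y, z) \<in> R" using V by (auto simp: R_def)
      then show "z \<in> R\<^sup>* `` {x}" using y by (auto intro: rtrancl_into_rtrancl)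
    qed
    then show "\<exists>V. openin X V \<and> y \<in> V \<and> V \<subseteq> R\<^sup>* `` {x}" using V op by blast
  qed
  moreover have "A = B" if AB: "A \<in> P" "B \<in> P" "A \<inter> B \<noteq> {}" for A B
  proof -
    obtain x y where A: "A = R\<^sup>* `` {x}" and B: "B = R\<^sup>* `` {y}" using AB by (auto simp: P_def)
    obtain z where "(x, z) \<in> R\<^sup>*" "(y, z) \<in> R\<^sup>*" using AB A B by auto
    then have "(x, y) \<in> R\<^sup>*" "(y, x) \<in> R\<^sup>*" using symR by (meson rtrancl_trans symD)+
    then show ?thesis unfolding A B by (auto intro: rtrancl_trans)
  qed
  ultimately have "top_direct_sum_of X P" unfolding top_direct_sum_of_def P_def by blast
  moreover have "countable (R\<^sup>* `` {x})" if x: "x \<in> topspace X" for x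
  proof -
    have R1: "countable (R `` {y})" for y
    proof (cases "y \<in> topspace X")
      case True
      have "R `` {y} = \<Union>{V \<in> \<V>. y \<in> V}" by (auto simp: R_def)
      moreover have "countable (\<Union>{V \<in> \<V>. y \<in> V})"
        using pt[OF True] cnt countable_UN[of "{V \<in> \<V>. y \<in> V}" "\<lambda>V. V"] by simp
      ultimately show ?thesis by simp
    next
      case False
      then have "R `` {y} = {}" using cov by (auto simp: R_def)
      then show ?thesis by simp
    qed
    \<comment> \<open>A class is the union over \<open>n\<close> of the points reachable in
      \<open>n\<close> steps, and a single step from a point reaches only the countably many
      countable members through it.\<close>
    have "countable ((R ^^ n) `` {x})" for n
    proof (induction n)
      case (Suc n)
      have "(R ^^ Suc n) `` {x} = (\<Union>y\<in>(R ^^ n) `` {x}. R `` {y})" by auto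
      then show ?case using Suc R1 by simp
    qed simp
    moreover have "R\<^sup>* `` {x} = (\<Union>n. (R ^^ n) `` {x})" by (auto simp: rtrancl_power)
    ultimately show ?thesis by simp
  qed
  ultimately show thesis by (intro that[of P]) (auto simp: P_def)
qed

text \<open>Truncate a metric of each piece at 1 and place points of different pieces at distance 1.
  Balls of radius at most 1 are then exactly the balls of the piece containing the centre, so the
  topologies agree because the pieces are open.\<close>

lemma metrizable_space_direct_sum:
  assumes P: "top_direct_sum_of X P" and met: "\<And>A. A \<in> P \<Longrightarrow> metrizable_space (subtopology X A)"
  shows "metrizable_space X"
proof -
  have un: "\<Union>P = topspace X" and op: "\<And>A. A \<in> P \<Longrightarrow> openin X A"
    using P by (auto simp: top_direct_sum_of_def)
  have dj: "\<And>A B x. A \<in> P \<Longrightarrow> B \<in> P \<Longrightarrow> x \<in> A \<Longrightarrow> x \<in> B \<Longrightarrow> A = B"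
    using P by (simp add: top_direct_sum_of_def) (metis IntI empty_iff)
  have "\<exists>d. Metric_space A d \<and> subtopology X A = Metric_space.mtopology A d" if A: "A \<in> P" for A
  proof -
    obtain M d where d: "Metric_space M d" "subtopology X A = Metric_space.mtopology M d"
      using met[OF A] by (auto simp: metrizable_space_def)
    have "M = topspace (subtopology X A)" using d by (simp add: Metric_space.topspace_mtopology)
    also have "\<dots> = A" using op[OF A] openin_subset by auto
    finally have "M = A" .
    then show ?thesis using d by (intro exI[of _ d]) simp
  qed
  then have "\<exists>d. \<forall>A\<in>P. Metric_space A (d A) \<and> subtopology X A = Metric_space.mtopology A (d A)"
    by (intro bchoice ballI)
  then obtain d where dd: "\<forall>A\<in>P. Metric_space A (d A) \<and> subtopology X A = Metric_space.mtopology A (d A)" ..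
  then have d: "\<And>A. A \<in> P \<Longrightarrow> Metric_space A (d A)"
      and top: "\<And>A. A \<in> P \<Longrightarrow> subtopology X A = Metric_space.mtopology A (d A)"
    by simp_all
  define p where "p x = (SOME A. A \<in> P \<and> x \<in> A)" for x
  have p: "p x \<in> P \<and> x \<in> p x" if "x \<in> topspace X" for x
  proof -
    have "\<exists>A. A \<in> P \<and> x \<in> A" using un that by blast
    then show ?thesis unfolding p_def by (rule someI_ex)
  qed
  have p_eq: "p x = A" if "A \<in> P" "x \<in> A" for x A
  proof -
    have "x \<in> topspace X" using that un by auto
    then show ?thesis using that p[of x] dj[of "p x" A x] by auto
  qed
  define D where "D x y = (if p x = p y then min 1 (d (p x) x y) else 1)" for x y
  \<comment> \<open>\<open>Metric_space\<close> demands nonnegativity and symmetry for all arguments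
    of the type, whereas \<open>p\<close>, and with it \<open>D\<close>, is controlled only on the
    space; hence the value 0 elsewhere.\<close>
  interpret Metric_space "topspace X" "\<lambda>x y. if x \<in> topspace X \<and> y \<in> topspace X then D x y else 0"
  proof
    fix x y z
    show "0 \<le> (if x \<in> topspace X \<and> y \<in> topspace X then D x y else 0)"
      using Metric_space.nonneg[OF d] p by (auto simp: D_def)
    show "(if x \<in> topspace X \<and> y \<in> topspace X then D x y else 0) = 
          (if y \<in> topspace X \<and> x \<in> topspace X then D y x else 0)"
      using Metric_space.commute[OF d] p by (auto simp: D_def)
    assume x: "x \<in> topspace X" and y: "y \<in> topspace X" 
    have px: "p x \<in> P" "x \<in> p x" and py: "p y \<in> P" "y \<in> p y" using p x y by auto
    show "((if x \<in> topspace X \<and> y \<in> topspace X then D x y else 0) = 0) = (x = y)"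
      using Metric_space.zero[OF d[OF px(1)] px(2), of y] py x y by (auto simp: D_def min_def)
    assume z: "z \<in> topspace X"
    have pz: "p z \<in> P" "z \<in> p z" using p z by auto
    have nn: "d (p x) u v \<ge> 0" "d (p y) u v \<ge> 0" "d (p z) u v \<ge> 0" for u v 
      using Metric_space.nonneg[OF d] px py pz by auto
    have "D x z \<le> D x y + D y z"
    proof (cases "p y = p x \<and> p z = p x")
      case True
      then have "d (p x) x z \<le> d (p x) x y + d (p x) y z"
        using Metric_space.triangle[OF d[OF px(1)] px(2), of y z] py pz by simp
      then show ?thesis using True nn(1)[of x y] nn(1)[of y z] by (simp add: D_def min_def)
    next
      case False
      then have "1 \<le> D x y \<or> 1 \<le> D y z" by (auto simp: D_def)
      moreover have "D x z \<le> 1" "0 \<le> D x y" "0 \<le> D y z" using nn by (simp_all add: D_def)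
      ultimately show ?thesis by linarith
    qed
    then show "(if x \<in> topspace X \<and> z \<in> topspace X then D x z else 0)
      \<le> (if x \<in> topspace X \<and> y \<in> topspace X then D x y else 0) +
         (if y \<in> topspace X \<and> z \<in> topspace X then D y z else 0)" using x y z by simp
  qed
  have ball: "mball x r = Metric_space.mball (p x) (d (p x)) x r" if "x \<in> topspace X" "r \<le> 1" for x r
  proof -
    have px: "p x \<in> P" "x \<in> p x" using p that by auto
    have "y \<in> mball x r \<longleftrightarrow> y \<in> p x \<and> d (p x) x y < r" for y
    proof (cases "y \<in> p x")
      case True
      have "p y = p x" using p_eq[OF px(1) True] .
      moreover have "y \<in> topspace X" using openin_subset[OF op[OF px(1)]] True by blast
      ultimately show ?thesis using True that unfolding in_mball by (simp add: D_def min_def)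
    next
      case False
      then have "y \<in> topspace X \<Longrightarrow> D x y = 1" using p[of y] by (auto simp: D_def)
      then show ?thesis using False that by auto
    qed
    then show ?thesis using px by (auto simp: Metric_space.in_mball[OF d])
  qed
  have "openin X U \<longleftrightarrow> openin mtopology U" for U
  proof
    assume U: "openin X U"
    show "openin mtopology U"
      unfolding openin_mtopology
    proof (intro conjI allI impI)
      show "U \<subseteq> topspace X" using U openin_subset by auto
      fix x assume "x \<in> U"
      then have x: "x \<in> topspace X" using U openin_subset by auto
      have px: "p x \<in> P" "x \<in> p x" using p x by auto
      have "openin (subtopology X (p x)) (U \<inter> p x)" using U by (auto simp: openin_subtopology)
      then obtain r where r: "r > 0" "Metric_space.mball (p x) (d (p x)) x r \<subseteq> U \<inter> p x"
        using px \<open>x \<in> U\<close> unfolding top[OF px(1)] Metric_space.openin_mtopology[OF d[OF px(1)]] by blast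
      have "mball x (min 1 r) \<subseteq> U"
        using r ball[OF x, of "min 1 r"] Metric_space.mball_subset_concentric[OF d[OF px(1)], of "min 1 r" r x]
        by auto
      then show "\<exists>r>0. mball x r \<subseteq> U" using r by (intro exI[of _ "min 1 r"]) auto
    qed
  next
    assume U: "openin mtopology U"
    show "openin X U"
    proof (subst openin_subopen, intro ballI)
      fix x assume "x \<in> U"
      then have x: "x \<in> topspace X" using U openin_subset by fastforce
      have px: "p x \<in> P" "x \<in> p x" using p x by auto
      obtain r where r: "r > 0" "mball x r \<subseteq> U" using U \<open>x \<in> U\<close> openin_mtopology by blast
      define V where "V = Metric_space.mball (p x) (d (p x)) x (min 1 r)"
      have "V \<subseteq> U" using r ball[OF x, of "min 1 r"] mball_subset_concentric[of "min 1 r" r x]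
        by (auto simp: V_def)
      moreover have "x \<in> V" using r px by (simp add: V_def Metric_space.centre_in_mball_iff[OF d])
      moreover have "openin (subtopology X (p x)) V"
        unfolding V_def top[OF px(1)] by (rule Metric_space.openin_mball[OF d[OF px(1)]])
      then have "openin X V" using op[OF px(1)] openin_trans_full by blast
      ultimately show "\<exists>V. openin X V \<and> x \<in> V \<and> V \<subseteq> U" by blast
    qed
  qed
  then have "X = mtopology" by (simp add: topology_eq)
  then show ?thesis using metrizable_space_mtopology by simp
qed

text \<open>Send \<open>x\<close> to the family of truth values of \<open>x \<in> C j\<close>. The
  map is continuous because the sets are clopen and injective because they separate points; from a
  compact space into a Hausdorff one it is an embedding, and a countable power of a discrete space
  is metrizable.\<close>

lemma metrizable_space_compact_countable_clopen_separation:
  assumes X: "compact_space X" and J: "countable J"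
    and cl: "\<And>j. j \<in> J \<Longrightarrow> openin X (C j) \<and> closedin X (C j)"
    and sep: "\<And>x y. x \<in> topspace X \<Longrightarrow> y \<in> topspace X \<Longrightarrow> x \<noteq> y \<Longrightarrow> \<exists>j\<in>J. (x \<in> C j) \<noteq> (y \<in> C j)"
  shows "metrizable_space X"
proof -
  define Y where "Y = product_topology (\<lambda>j. discrete_topology (UNIV :: bool set)) J"
  define f where "f x = (\<lambda>j\<in>J. x \<in> C j)" for x
  have metY: "metrizable_space Y"
    unfolding Y_def by (subst metrizable_space_product_topology) (use J in \<open>auto intro: countable_subset\<close>)
  have "continuous_map X (discrete_topology UNIV) (\<lambda>x. x \<in> C j)" if j: "j \<in> J" for j
  proof -
    have "openin X {x \<in> topspace X. (x \<in> C j) \<in> B}" for B :: "bool set"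
    proof -
      have 1: "openin X (C j)" and 2: "openin X (topspace X - C j)" and sub: "C j \<subseteq> topspace X"
        using cl[OF j] openin_subset by auto
      have "{x \<in> topspace X. (x \<in> C j) \<in> B} = 
         (if True \<in> B then C j else {}) \<union> (if False \<in> B then topspace X - C j else {})"
        using sub by auto (metis (full_types))+
      then show ?thesis using 1 2 by auto
    qed
    then show ?thesis by (auto simp: continuous_map)
  qed
  then have "continuous_map X Y f"
    unfolding Y_def f_def by (auto simp: continuous_map_componentwise)
  moreover have "inj_on f (topspace X)"
  proof (rule inj_onI, rule ccontr)
    fix x y assume "x \<in> topspace X" "y \<in> topspace X" "f x = f y" "x \<noteq> y"
    then obtain j where "j \<in> J" "(x \<in> C j) \<noteq> (y \<in> C j)" using sep by blast
    then show False using fun_cong[OF \<open>f x = f y\<close>, of j] by (auto simp: f_def)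
  qed
  ultimately have "homeomorphic_map X (subtopology Y (f ` topspace X)) f"
    using X metrizable_imp_Hausdorff_space[OF metY] continuous_map_image_subset_topspace[of X Y f]
    by (intro continuous_imp_homeomorphic_map)
       (auto simp: continuous_map_in_subtopology Hausdorff_space_subtopology)
  then have "X homeomorphic_space subtopology Y (f ` topspace X)"
    using homeomorphic_map_imp_homeomorphic_space by blast
  then show ?thesis
    using homeomorphic_metrizable_space metrizable_space_subtopology[OF metY] by blast
qed

section \<open>The interval topology of a tree\<close>

locale tree =
  fixes T :: "'a::order set"
  assumes tree: "is_tree T"
begin

abbreviation X :: "'a topology" where "X \<equiv> interval_topology T"

definition below :: "'a \<Rightarrow> 'a set" where "below t = {x \<in> T. x \<le> t}"

lemma comparable:
  assumes "t \<in> T" "x \<in> T" "y \<in> T" "x \<le> t" "y \<le> t"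
  shows "x \<le> y \<or> y \<le> x"
proof (cases "x = t \<or> y = t")
  case False
  then have "x \<in> preds T t" "y \<in> preds T t" using assms by (auto simp: preds_def)
  then show ?thesis using tree assms(1) by (auto simp: is_tree_def well_ordered_set_def)
qed (use assms in auto)

text \<open>Well-ordered predecessor sets make the whole tree order well-founded: a least element of
  the part of \<open>Q\<close> below any chosen member is minimal in \<open>Q\<close>.\<close>

lemma ex_minimal:
  assumes "Q \<subseteq> T" "Q \<noteq> {}"
  obtains m where "m \<in> Q" "\<And>q. q \<in> Q \<Longrightarrow> \<not> q < m"
proof -
  obtain t where t: "t \<in> Q" using assms by auto
  show thesis
  proof (cases "Q \<inter> preds T t = {}")
    case True
    then show thesis using t assms(1) by (intro that[of t]) (auto simp: preds_def)
  next
    case False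
    have "well_ordered_set (preds T t)" using tree t assms(1) by (auto simp: is_tree_def)
    then obtain m where m: "m \<in> Q \<inter> preds T t" "\<And>a. a \<in> Q \<inter> preds T t \<Longrightarrow> m \<le> a"
      using False unfolding well_ordered_set_def by (metis Int_lower2)
    have "\<not> q < m" if "q \<in> Q" for q
    proof
      assume "q < m"
      moreover from this have "q \<in> Q \<inter> preds T t" using m that assms(1) by (auto simp: preds_def)
      ultimately show False using m(2) by (auto simp: less_le_not_le)
    qed
    then show thesis using m by (intro that[of m]) auto
  qed
qed

lemma chain_ex_least:
  assumes "is_chain_in T C" "Q \<subseteq> C" "Q \<noteq> {}"
  obtains m where "m \<in> Q" "\<And>q. q \<in> Q \<Longrightarrow> m \<le> q"
proof -
  have "Q \<subseteq> T" using assms by (auto simp: is_chain_in_def)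
  then obtain m where m: "m \<in> Q" "\<And>q. q \<in> Q \<Longrightarrow> \<not> q < m" using ex_minimal assms(3) by metis
  have "m \<le> q" if "q \<in> Q" for q
  proof -
    have "m \<le> q \<or> q \<le> m" using assms m(1) that by (auto simp: is_chain_in_def)
    then show ?thesis using m(2)[OF that] by (auto simp: order.order_iff_strict)
  qed
  then show thesis using m that by blast
qed

lemma less_induct_on [consumes 1, case_names less]:
  assumes "t \<in> T" and step: "\<And>t. t \<in> T \<Longrightarrow> (\<And>s. s \<in> T \<Longrightarrow> s < t \<Longrightarrow> Q s) \<Longrightarrow> Q t"
  shows "Q t"
proof (rule ccontr)
  assume "\<not> Q t"
  then obtain m where "m \<in> {s \<in> T. \<not> Q s}" "\<And>q. q \<in> {s \<in> T. \<not> Q s} \<Longrightarrow> \<not> q < m"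
    using ex_minimal[of "{s \<in> T. \<not> Q s}"] assms(1) by auto
  then show False using step[of m] by blast
qed

text \<open>Only intervals ending at \<open>t\<close> itself have to be tested at \<open>t\<close>.
  The condition passes to intersections because two left ends below \<open>t\<close> are comparable
  and the larger one serves both sets; at minimal points nothing is required, as their singletons
  are basic.\<close>

lemma openin_X_iff:
  "openin X U \<longleftrightarrow> U \<subseteq> T \<and>
     (\<forall>t\<in>U. (\<exists>s\<in>T. s < t) \<longrightarrow> (\<exists>s\<in>T. s < t \<and> {x \<in> T. s < x \<and> x \<le> t} \<subseteq> U))"
  (is "_ \<longleftrightarrow> ?R U")
proof
  assume "openin X U"
  then have "generate_topology_on ({{x \<in> T. s < x \<and> x \<le> t} | s t. s \<in> T \<and> t \<in> T} \<union>
      {{t} | t. t \<in> T \<and> \<not> (\<exists>s\<in>T. s < t)}) U"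
    unfolding interval_topology_def by (rule openin_topology_generated_by)
  then show "?R U"
  proof induction
    case Empty then show ?case by simp
  next
    case (Int V W)
    have "\<exists>s\<in>T. s < t \<and> {x \<in> T. s < x \<and> x \<le> t} \<subseteq> V \<inter> W" if t: "t \<in> V \<inter> W" and ex: "\<exists>s\<in>T. s < t" for t
    proof -
      obtain s1 where s1: "s1 \<in> T" "s1 < t" "{x \<in> T. s1 < x \<and> x \<le> t} \<subseteq> V" using Int.IH(1) t ex by blast
      obtain s2 where s2: "s2 \<in> T" "s2 < t" "{x \<in> T. s2 < x \<and> x \<le> t} \<subseteq> W" using Int.IH(2) t ex by blast
      have "t \<in> T" using Int.IH t by blast
      then consider "s1 \<le> s2" | "s2 \<le> s1" using comparable[of t s1 s2] s1(1,2) s2(1,2) by (auto simp: less_imp_le)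
      then show ?thesis
      proof cases
        case 1
        then have "{x \<in> T. s2 < x \<and> x \<le> t} \<subseteq> V \<inter> W" using s1 s2 by (auto dest: order.strict_trans1)
        then show ?thesis using s2 by blast
      next
        case 2
        then have "{x \<in> T. s1 < x \<and> x \<le> t} \<subseteq> V \<inter> W" using s1 s2 by (auto dest: order.strict_trans1)
        then show ?thesis using s1 by blast
      qed
    qed
    then show ?case using Int.IH by blast
  next
    case (UN K)
    have "\<exists>s\<in>T. s < t \<and> {x \<in> T. s < x \<and> x \<le> t} \<subseteq> \<Union>K" if t: "t \<in> \<Union>K" and ex: "\<exists>s\<in>T. s < t" for t
    proof -
      obtain V where V: "V \<in> K" "t \<in> V" using t by blast
      then obtain s where "s \<in> T" "s < t" "{x \<in> T. s < x \<and> x \<le> t} \<subseteq> V"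
        using UN.IH[OF V(1)] ex by blast
      then show ?thesis using V by blast
    qed
    then show ?case using UN.IH by blast
  next
    case (Basis V)
    then consider s t where "s \<in> T" "t \<in> T" "V = {x \<in> T. s < x \<and> x \<le> t}"
      | t where "t \<in> T" "\<not> (\<exists>s\<in>T. s < t)" "V = {t}" by blast
    then show ?case
    proof cases
      case 1
      have "{x \<in> T. s < x \<and> x \<le> y} \<subseteq> V" if "y \<in> V" for y using 1 that by auto
      then show ?thesis using 1 by blast
    next
      case 2 then show ?thesis by auto
    qed
  qed
next
  assume R: "?R U"
  show "openin X U"
  proof (subst openin_subopen, intro ballI)
    fix t assume t: "t \<in> U"
    show "\<exists>V. openin X V \<and> t \<in> V \<and> V \<subseteq> U"
    proof (cases "\<exists>s\<in>T. s < t")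
      case True
      then obtain s where s: "s \<in> T" "s < t" "{x \<in> T. s < x \<and> x \<le> t} \<subseteq> U" using R t by blast
      have "t \<in> T" using R t by auto
      then have "openin X {x \<in> T. s < x \<and> x \<le> t}"
        unfolding interval_topology_def using s by (intro topology_generated_by_Basis) blast
      then show ?thesis using s \<open>t \<in> T\<close> by (intro exI[of _ "{x \<in> T. s < x \<and> x \<le> t}"]) simp
    next
      case False
      have "t \<in> T" using R t by auto
      then have "openin X {t}"
        unfolding interval_topology_def using False by (intro topology_generated_by_Basis) blast
      then show ?thesis using t by (intro exI[of _ "{t}"]) simp
    qed
  qed
qed

lemma topspace_X [simp]: "topspace X = T"
proof
  show "topspace X \<subseteq> T" using openin_X_iff openin_topspace by blast
  have "openin X T" by (auto simp: openin_X_iff)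
  then show "T \<subseteq> topspace X" by (rule openin_subset)
qed

lemma openin_down_closed:
  assumes "U \<subseteq> T" "\<And>x y. x \<in> U \<Longrightarrow> y \<in> T \<Longrightarrow> y \<le> x \<Longrightarrow> y \<in> U"
  shows "openin X U"
  using assms by (auto simp: openin_X_iff)

lemma openin_below: "openin X (below t)"
  by (rule openin_down_closed) (auto simp: below_def)

text \<open>Well-founded induction on \<open>t\<close>: a member of the cover containing
  \<open>t\<close> swallows some interval (s,t], and by comparability all the rest lies in
  \<open>below s\<close>.\<close>

lemma compactin_below:
  assumes "t \<in> T" shows "compactin X (below t)"
  using assms
proof (induction t rule: less_induct_on)
  case (less t)
  show ?case
    unfolding compactin_def
  proof (intro conjI allI impI)
    show "below t \<subseteq> topspace X" by (auto simp: below_def)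
    fix \<U> assume \<U>: "Ball \<U> (openin X) \<and> below t \<subseteq> \<Union>\<U>"
    have "t \<in> below t" using less.hyps by (auto simp: below_def)
    then obtain U where U: "U \<in> \<U>" "t \<in> U" using \<U> by blast
    show "\<exists>\<F>. finite \<F> \<and> \<F> \<subseteq> \<U> \<and> below t \<subseteq> \<Union>\<F>"
    proof (cases "\<exists>s\<in>T. s < t")
      case True
      moreover have "openin X U" using U \<U> by blast
      ultimately obtain s where s: "s \<in> T" "s < t" "{x \<in> T. s < x \<and> x \<le> t} \<subseteq> U"
        using U(2) by (auto simp: openin_X_iff)
      have "below s \<subseteq> below t" using s(2) by (auto simp: below_def)
      then have "below s \<subseteq> \<Union>\<U>" using \<U> by blast
      then have "\<exists>\<F>. finite \<F> \<and> \<F> \<subseteq> \<U> \<and> below s \<subseteq> \<Union>\<F>"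
        using less.IH[OF s(1,2)] \<U> by (simp add: compactin_def)
      then obtain \<F> where F: "finite \<F>" "\<F> \<subseteq> \<U>" "below s \<subseteq> \<Union>\<F>" by blast
      have "x \<in> below s \<or> x \<in> U" if "x \<in> below t" for x
        using comparable[of t x s] that s less.hyps by (auto simp: below_def order.order_iff_strict)
      then have "below t \<subseteq> \<Union>(insert U \<F>)" using F by blast
      then show ?thesis using F U by (intro exI[of _ "insert U \<F>"]) simp
    next
      case False
      then have "below t = {t}" using less.hyps by (auto simp: below_def order.order_iff_strict)
      then show ?thesis using U by (intro exI[of _ "{U}"]) auto
    qed
  qed
qed

section \<open>Branches and initial segments of the first uncountable ordinal\<close>

lemma ex_branch_superset:
  assumes "is_chain_in T C" obtains B where "is_branch T B" "C \<subseteq> B"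
proof -
  let ?\<A> = "{D. is_chain_in T D \<and> C \<subseteq> D}"
  have "\<exists>M\<in>?\<A>. \<forall>D\<in>?\<A>. M \<subseteq> D \<longrightarrow> D = M"
  proof (rule subset_Zorn_nonempty)
    show "?\<A> \<noteq> {}" using assms by blast
    fix \<C> assume ne: "\<C> \<noteq> {}" and ch: "subset.chain ?\<A> \<C>"
    have 1: "D \<in> ?\<A>" if "D \<in> \<C>" for D using ch that by (auto simp: subset_chain_def)
    have "x \<le> y \<or> y \<le> x" if "D \<in> \<C>" "E \<in> \<C>" "x \<in> D" "y \<in> E" for D E x y
    proof -
      have "D \<subseteq> E \<or> E \<subseteq> D" using ch that by (auto simp: subset_chain_def)
      then have "(x \<in> E \<and> y \<in> E) \<or> (x \<in> D \<and> y \<in> D)" using that by blast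
      then show ?thesis using 1[OF that(1)] 1[OF that(2)] by (auto simp: is_chain_in_def)
    qed
    moreover have "\<Union>\<C> \<subseteq> T" using 1 unfolding is_chain_in_def by blast
    ultimately have "is_chain_in T (\<Union>\<C>)" unfolding is_chain_in_def by blast
    then show "\<Union>\<C> \<in> ?\<A>" using 1 ne by auto
  qed
  then obtain M where "is_chain_in T M" "C \<subseteq> M" "\<And>D. is_chain_in T D \<Longrightarrow> M \<subseteq> D \<Longrightarrow> D = M"
    by (auto intro: order.trans)
  then show thesis by (intro that[of M]) (auto simp: is_branch_def)
qed

lemma is_chain_below: "t \<in> T \<Longrightarrow> is_chain_in T (below t)"
  using comparable by (auto simp: is_chain_in_def below_def)

lemma countable_below:
  assumes "\<And>B. is_branch T B \<Longrightarrow> countable B" "t \<in> T" shows "countable (below t)"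
  using ex_branch_superset[OF is_chain_below[OF assms(2)]] assms(1) countable_subset by metis

text \<open>Such a \<open>y\<close> is comparable with every member of the branch: transitivity
  settles the members above \<open>x\<close>, and those below \<open>x\<close> share with
  \<open>y\<close> the upper bound \<open>x\<close>. Maximality puts \<open>y\<close> into the
  branch.\<close>

lemma branch_down_closed:
  assumes B: "is_branch T B" and "x \<in> B" "y \<in> T" "y \<le> x" shows "y \<in> B"
proof -
  have ch: "is_chain_in T B" using B by (simp add: is_branch_def)
  have "y \<le> z \<or> z \<le> y" if "z \<in> B" for z
  proof -
    have "x \<in> T" "z \<in> T" "x \<le> z \<or> z \<le> x" using ch assms that by (auto simp: is_chain_in_def)
    then show ?thesis using comparable[of x y z] assms by (auto intro: order.trans)
  qed
  then have "is_chain_in T (insert y B)" using ch assms by (auto simp: is_chain_in_def)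
  then show ?thesis using B unfolding is_branch_def by blast
qed

text \<open>A down-closed chain all of whose points have countably many predecessors is an initial segment
  of the first uncountable ordinal; if it is uncountable then it is countably compact, so no locally
  finite family of nonempty sets in it is infinite.\<close>
lemma not_paracompact_omega1_segment:
  assumes ch: "is_chain_in T W" and dn: "\<And>x y. x \<in> W \<Longrightarrow> y \<in> T \<Longrightarrow> y \<le> x \<Longrightarrow> y \<in> W"
    and unc: "uncountable W" and cnt: "\<And>w. w \<in> W \<Longrightarrow> countable (below w)"
  shows "\<not> paracompact_space (subtopology X W)"
proof
  assume para: "paracompact_space (subtopology X W)"
  have WT: "W \<subseteq> T" and lin: "\<And>x y. x \<in> W \<Longrightarrow> y \<in> W \<Longrightarrow> x \<le> y \<or> y \<le> x"
    using ch by (auto simp: is_chain_in_def)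
  have oW: "openin X W" using openin_down_closed WT dn by blast
  have top: "topspace (subtopology X W) = W" using WT by auto
  \<comment> \<open>Without a strict upper bound, \<open>W\<close> would be the union of the
    countable sets \<open>below c\<close> over countably many \<open>c\<close>.\<close>
  have bdd: "\<exists>u\<in>W. \<forall>c\<in>C. c < u" if C: "C \<subseteq> W" "countable C" for C
  proof (rule ccontr)
    assume neg: "\<not> ?thesis"
    have "W \<subseteq> (\<Union>c\<in>C. below c)"
    proof
      fix u assume u: "u \<in> W"
      then obtain c where "c \<in> C" "\<not> c < u" using neg by blast
      then have "c \<in> C" "u \<le> c" using lin[of c u] u C by (auto simp: order.order_iff_strict)
      then show "u \<in> (\<Union>c\<in>C. below c)" using u WT by (auto simp: below_def)
    qed
    moreover have "countable (\<Union>c\<in>C. below c)" using C cnt by (intro countable_UN) auto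
    ultimately show False using unc countable_subset by blast
  qed
  have below_W: "below w \<subseteq> W" if "w \<in> W" for w using dn that by (auto simp: below_def)
  have op_below: "openin (subtopology X W) U" if "U \<in> below ` W" for U
    using openin_below below_W that by (auto simp: openin_open_subtopology oW)
  have cov_below: "\<Union>(below ` W) = topspace (subtopology X W)"
    unfolding top using below_W WT by (auto simp: below_def)
  obtain \<V> where V: "\<forall>V\<in>\<V>. openin (subtopology X W) V" "\<Union>\<V> = W" 
      "\<forall>V\<in>\<V>. \<exists>U\<in>below ` W. V \<subseteq> U" "locally_finite_in (subtopology X W) \<V>"
    using paracompact_space_refinement[OF para op_below cov_below] unfolding top by blast
  \<comment> \<open>A member of the refinement lies in some \<open>below w\<close>, so a single
    point \<open>h\<close> of \<open>W\<close> exceeds all of it. Iterating \<open>h\<close> gives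
    an increasing sequence that leaves each chosen member after one step.\<close>
  have "\<exists>V h. V \<in> \<V> \<and> x \<in> V \<and> h \<in> W \<and> x < h \<and> (\<forall>v\<in>V. v < h)" if "x \<in> W" for x
  proof -
    obtain V where V': "V \<in> \<V>" "x \<in> V" using V(2) \<open>x \<in> W\<close> by blast
    then obtain w where w: "w \<in> W" "V \<subseteq> below w" using V(3) by blast
    obtain h where h: "h \<in> W" "\<forall>c\<in>{w}. c < h" using bdd[of "{w}"] w by auto
    have "\<forall>v\<in>V. v < h" using w h by (auto simp: below_def)
    then show ?thesis using V' h by blast
  qed
  then obtain v h where vh: "\<And>x. x \<in> W \<Longrightarrow> v x \<in> \<V> \<and> x \<in> v x \<and> h x \<in> W \<and> x < h x \<and> (\<forall>y\<in>v x. y < h x)"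
    by metis
  obtain x0 where "x0 \<in> W" using unc by fastforce
  define x where "x n = (h ^^ n) x0" for n
  have xW: "x n \<in> W" for n
    by (induction n) (use \<open>x0 \<in> W\<close> vh in \<open>auto simp: x_def\<close>)
  have x_Suc: "x (Suc n) = h (x n)" for n by (simp add: x_def)
  have "x n < x (Suc n)" for n using vh[OF xW] x_Suc by simp
  then have smono: "strict_mono x" by (rule strict_mono_Suc_iff[THEN iffD2, rule_format])
  have inj_v: "inj (\<lambda>n. v (x n))"
  proof -
    have "v (x m) \<noteq> v (x n)" if "m < n" for m n
    proof
      assume "v (x m) = v (x n)"
      then have "x n \<in> v (x m)" using vh[OF xW[of n]] by simp
      then have "x n < x (Suc m)" using vh[OF xW[of m]] x_Suc by simp
      moreover have "x (Suc m) \<le> x n" using smono that by (simp add: strict_mono_less_eq)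
      ultimately show False by (simp add: less_le_not_le)
    qed
    then show ?thesis by (metis injI linorder_neqE_nat)
  qed
  obtain u where u: "u \<in> W" "\<forall>c\<in>range x. c < u" using bdd[of "range x"] xW by auto
  \<comment> \<open>The least strict upper bound \<open>s\<close> of the sequence is its limit:
    every neighbourhood of \<open>s\<close> contains a tail, and so meets infinitely many of the
    distinct members \<open>v (x n)\<close>.\<close>
  define Q where "Q = {u \<in> W. \<forall>n. x n < u}"
  have "Q \<subseteq> W" "Q \<noteq> {}" using u by (auto simp: Q_def)
  then obtain s where s: "s \<in> Q" "\<And>q. q \<in> Q \<Longrightarrow> s \<le> q" using chain_ex_least[OF ch] by metis
  have sW: "s \<in> W" and xs: "\<And>n. x n < s" using s by (auto simp: Q_def)
  then obtain N where N: "openin (subtopology X W) N" "s \<in> N" "finite {V \<in> \<V>. V \<inter> N \<noteq> {}}"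
    using V(4) top unfolding locally_finite_in_def by metis
  have "openin X N" using N(1) oW openin_trans_full by blast
  moreover have "\<exists>a\<in>T. a < s" using xs xW WT by blast
  ultimately obtain a where a: "a \<in> T" "a < s" "{y \<in> T. a < y \<and> y \<le> s} \<subseteq> N"
    using N(2) by (auto simp: openin_X_iff)
  have aW: "a \<in> W" using dn[OF sW a(1)] a(2) by simp
  have "a \<notin> Q" using s(2)[of a] a(2) by (auto simp: less_le_not_le)
  then obtain k where "\<not> x k < a" using aW by (auto simp: Q_def)
  then have "a \<le> x k" using lin[OF aW xW[of k]] by (auto simp: order.order_iff_strict)
  have "v (x n) \<in> {V \<in> \<V>. V \<inter> N \<noteq> {}}" if "n > k" for n
  proof -
    have "x k < x n" using smono that by (simp add: strict_mono_less)
    then have "a < x n" using \<open>a \<le> x k\<close> by order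
    then have "x n \<in> N" using a(3) xW[of n] WT xs[of n] by (auto simp: less_imp_le)
    then show ?thesis using vh[OF xW[of n]] by blast
  qed
  then have "(\<lambda>n. v (x n)) ` {k<..} \<subseteq> {V \<in> \<V>. V \<inter> N \<noteq> {}}" by blast
  then have "finite ((\<lambda>n. v (x n)) ` {k<..})" using N(3) finite_subset by blast
  then have "finite {k<..}" using inj_v by (meson finite_imageD inj_on_subset subset_UNIV)
  then show False using infinite_Ioi by blast
qed

text \<open>An uncountable branch may itself be paracompact: the successor of the first uncountable
  ordinal is compact. If some point of the branch has uncountably many predecessors, the
  contradiction is therefore found on the strict predecessors of a minimal point of this kind; this
  is where paracompactness of subspaces is essential.\<close>

lemma hereditarily_paracompact_imp_countable_branch:
  assumes "hereditarily_paracompact X" and B: "is_branch T B"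
  shows "countable B"
proof (rule ccontr)
  assume unc: "uncountable B"
  have ch: "is_chain_in T B" and BT: "B \<subseteq> T" using B by (auto simp: is_branch_def is_chain_in_def)
  have para: "paracompact_space (subtopology X W)" if "W \<subseteq> T" for W
    using assms(1) that by (simp add: hereditarily_paracompact_def)
  show False
  proof (cases "\<exists>t\<in>B. uncountable (below t)")
    case False
    then show False
      using not_paracompact_omega1_segment[OF ch _ unc] branch_down_closed[OF B] para[OF BT] by blast
  next
    case True
    define Q where "Q = {t \<in> T. uncountable (below t)}"
    have "Q \<subseteq> T" "Q \<noteq> {}" using True BT by (auto simp: Q_def)
    then obtain m where m: "m \<in> Q" "\<And>q. q \<in> Q \<Longrightarrow> \<not> q < m" using ex_minimal by metis
    have mT: "m \<in> T" using m by (simp add: Q_def)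
    have eq: "below m = insert m (preds T m)"
      using mT by (auto simp: below_def preds_def order.order_iff_strict)
    have "uncountable (preds T m)" using m(1) eq by (simp add: Q_def)
    moreover have "is_chain_in T (preds T m)"
      using is_chain_below[OF mT] unfolding eq is_chain_in_def by blast
    moreover have "countable (below w)" if "w \<in> preds T m" for w
      using m(2)[of w] that by (auto simp: Q_def preds_def)
    moreover have "y \<in> preds T m" if "x \<in> preds T m" "y \<in> T" "y \<le> x" for x y
      using that by (auto simp: preds_def)
    ultimately have "\<not> paracompact_space (subtopology X (preds T m))"
      by (intro not_paracompact_omega1_segment) blast+
    moreover have "preds T m \<subseteq> T" by (auto simp: preds_def)
    ultimately show False using para by blast
  qed
qed

end

section \<open>Trees whose nontrivial pseudo-suprema are suprema\<close>

locale hausdorff_tree = tree +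
  assumes psups: "nontrivial_psups_are_sups T"
begin

text \<open>A point \<open>y\<close> of limit type is a minimal upper bound of its own predecessors:
  a smaller upper bound would be a greatest predecessor. The hypothesis on pseudo-suprema turns this
  into a supremum.\<close>

lemma limit_le:
  assumes "y \<in> T" "preds T y \<noteq> {}" "\<not> (\<exists>m\<in>preds T y. \<forall>c\<in>preds T y. c \<le> m)"
    and "u \<in> T" "\<And>c. c \<in> preds T y \<Longrightarrow> c \<le> u"
  shows "y \<le> u"
proof -
  have "is_chain_in T (preds T y)"
    using comparable[OF assms(1)] by (auto simp: is_chain_in_def preds_def less_imp_le)
  moreover have "y \<in> pseudo_sup T (preds T y)"
    using assms(1,3) by (auto simp: pseudo_sup_def upper_bounds_in_def preds_def)
  moreover have "u \<in> upper_bounds_in T (preds T y)"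
    using assms(4,5) by (auto simp: upper_bounds_in_def)
  ultimately show ?thesis using psups assms(2,3) unfolding nontrivial_psups_are_sups_def by blast
qed

text \<open>Let \<open>y\<close> not lie below \<open>t\<close>. If some predecessor
  \<open>s\<close> of \<open>y\<close> does not either, (s,y] avoids \<open>below t\<close>.
  Otherwise \<open>limit_le\<close> rules out that \<open>y\<close> is of limit type, so a
  non-minimal \<open>y\<close> has a greatest predecessor \<open>m\<close>, and (m,y] is just
  \<open>y\<close>.\<close>

lemma closedin_below:
  assumes t: "t \<in> T" shows "closedin X (below t)"
proof -
  have "\<exists>s\<in>T. s < y \<and> {x \<in> T. s < x \<and> x \<le> y} \<subseteq> T - below t"
    if y: "y \<in> T" "\<not> y \<le> t" and ex: "\<exists>s\<in>T. s < y" for y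
  proof (cases "\<exists>s\<in>preds T y. \<not> s \<le> t")
    case True
    then obtain s where "s \<in> T" "s < y" "\<not> s \<le> t" by (auto simp: preds_def)
    then show ?thesis by (intro bexI[of _ s]) (auto simp: below_def)
  next
    case False
    have "preds T y \<noteq> {}" using ex by (auto simp: preds_def)
    then obtain m where m: "m \<in> preds T y" "\<forall>c\<in>preds T y. c \<le> m"
      using limit_le[OF y(1) _ _ t] False y(2) by blast
    have "x = y" if "x \<in> T" "m < x" "x \<le> y" for x
    proof (rule ccontr)
      assume "x \<noteq> y"
      then have "x \<in> preds T y" using that by (simp add: preds_def)
      then show False using m(2) \<open>m < x\<close> by (auto simp: less_le_not_le)
    qed
    then have "{x \<in> T. m < x \<and> x \<le> y} \<subseteq> T - below t" using y by (auto simp: below_def)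
    moreover have "m \<in> T" "m < y" using m(1) by (auto simp: preds_def)
    ultimately show ?thesis by blast
  qed
  then have "openin X (T - below t)" unfolding openin_X_iff by (auto simp: below_def)
  then show ?thesis unfolding closedin_def by (auto simp: below_def)
qed

text \<open>The ordinal is \<open>A\<close> with its own order. For an arbitrary subset of a chain
  the subspace topology can be strictly finer than the order topology; compactness excludes this,
  because the identity onto the Hausdorff order topology is continuous.\<close>

lemma homeomorphic_to_ordinal_compact_chain:
  assumes A: "A \<subseteq> below t" "t \<in> T" and comp: "compact_space (subtopology X A)"
  shows "homeomorphic_to_ordinal (subtopology X A)"
proof -
  define r where "r = {(x, y). x \<in> A \<and> y \<in> A \<and> x \<le> y}"
  have AT: "A \<subseteq> T" using A by (auto simp: below_def)
  have ch: "is_chain_in T A" using is_chain_below[OF A(2)] A(1) by (auto simp: is_chain_in_def)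
  have lin: "x \<le> y \<or> y \<le> x" if "x \<in> A" "y \<in> A" for x y
    using ch that by (auto simp: is_chain_in_def)
  have Fr: "Field r = A" by (auto simp: r_def Field_def)
  have "wf (r - Id)"
  proof (rule wfI_min)
    fix x :: 'a and Q assume "x \<in> Q"
    show "\<exists>z\<in>Q. \<forall>y. (y, z) \<in> r - Id \<longrightarrow> y \<notin> Q"
    proof (cases "Q \<inter> A = {}")
      case True then show ?thesis using \<open>x \<in> Q\<close> by (auto simp: r_def)
    next
      case False
      then obtain m where m: "m \<in> Q \<inter> A" "\<And>q. q \<in> Q \<inter> A \<Longrightarrow> m \<le> q"
        using chain_ex_least[OF ch, of "Q \<inter> A"] by blast
      then show ?thesis by (intro bexI[of _ m]) (auto simp: r_def dest: order.antisym)
    qed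
  qed
  then have wo: "Well_order r"
    unfolding Fr order_on_defs
    using lin by (auto simp: r_def refl_on_def trans_def antisym_def total_on_def)
  have lt: "{x. x \<noteq> a \<and> (x, a) \<in> r} = {x \<in> A. x < a}" if "a \<in> A" for a
    using that by (auto simp: r_def)
  have gt: "{x. x \<noteq> a \<and> (a, x) \<in> r} = {x \<in> A. a < x}" if "a \<in> A" for a
    using that by (auto simp: r_def)
  have gt': "{x \<in> A. a < x} = A - below a" if "a \<in> A" for a
    using lin[OF that] AT by (auto simp: below_def less_le_not_le)
  define Y where "Y = wo_order_topology r"
  have topY: "topspace Y = A"
    unfolding Y_def wo_order_topology_def topology_generated_by_topspace Fr by (auto simp: r_def)
  have open_lt: "openin Y {x \<in> A. x < a}" and open_gt: "openin Y {x \<in> A. a < x}" if "a \<in> A" for a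
    unfolding lt[OF that, symmetric] gt[OF that, symmetric] Y_def wo_order_topology_def Fr
    using that by (auto intro!: topology_generated_by_Basis)
  have "continuous_map (subtopology X A) Y id"
    unfolding Y_def wo_order_topology_def continuous_on_generated_topo_iff
  proof (intro conjI allI impI)
    fix U assume "U \<in> {Field r} \<union> {{x. x \<noteq> a \<and> (x, a) \<in> r} |a. a \<in> Field r} \<union>
             {{x. x \<noteq> a \<and> (a, x) \<in> r} |a. a \<in> Field r}"
    then consider "U = A" | a where "a \<in> A" "U = {x \<in> A. x < a}" | a where "a \<in> A" "U = A - below a"
      unfolding Fr using lt gt gt' by auto
    then have "openin (subtopology X A) U"
    proof cases
      case 1 then show ?thesis using AT by (metis openin_topspace topspace_X topspace_subtopology_subset)
    next
      case 2
      have "openin X {x \<in> T. x < a}" by (rule openin_down_closed) auto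
      moreover have "U = {x \<in> T. x < a} \<inter> A" using 2 AT by auto
      ultimately show ?thesis by (auto simp: openin_subtopology)
    next
      case 3
      have "openin X (T - below a)" using closedin_below[of a] 3 AT by (auto simp: closedin_def)
      moreover have "U = (T - below a) \<inter> A" using 3 AT by auto
      ultimately show ?thesis by (auto simp: openin_subtopology)
    qed
    moreover have "id -` U \<inter> topspace (subtopology X A) = U"
      using openin_subset[OF calculation] by auto
    ultimately show "openin (subtopology X A) (id -` U \<inter> topspace (subtopology X A))" by simp
  next
    show "id ` topspace (subtopology X A) \<subseteq> \<Union> ({Field r} \<union> {{x. x \<noteq> a \<and> (x, a) \<in> r} |a. a \<in> Field r} \<union>
             {{x. x \<noteq> a \<and> (a, x) \<in> r} |a. a \<in> Field r})"
      unfolding Fr by auto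
  qed
  moreover have "Hausdorff_space Y"
    unfolding Hausdorff_space_def topY
  proof (intro allI impI, elim conjE)
    have *: "\<exists>U V. openin Y U \<and> openin Y V \<and> x \<in> U \<and> y \<in> V \<and> disjnt U V"
      if "x \<in> A" "y \<in> A" "x < y" for x y
    proof (cases "\<exists>z\<in>A. x < z \<and> z < y")
      case True
      then obtain z where z: "z \<in> A" "x < z" "z < y" by blast
      then show ?thesis using open_lt[of z] open_gt[of z] that
        by (intro exI[of _ "{x \<in> A. x < z}"] exI[of _ "{x \<in> A. z < x}"]) (auto simp: disjnt_def)
    next
      case False
      \<comment> \<open>With no point of \<open>A\<close> strictly between them, the rays below
        \<open>y\<close> and above \<open>x\<close> are already disjoint.\<close>
      then show ?thesis using open_lt[of y] open_gt[of x] that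
        by (intro exI[of _ "{z \<in> A. z < y}"] exI[of _ "{z \<in> A. x < z}"]) (auto simp: disjnt_def)
    qed
    fix x y assume "x \<in> A" "y \<in> A" "x \<noteq> y"
    then consider "x < y" | "y < x" using lin[of x y] by (auto simp: order.order_iff_strict)
    then show "\<exists>U V. openin Y U \<and> openin Y V \<and> x \<in> U \<and> y \<in> V \<and> disjnt U V"
    proof cases
      case 1 then show ?thesis using * \<open>x \<in> A\<close> \<open>y \<in> A\<close> by blast
    next
      case 2 then show ?thesis using *[of y x] \<open>x \<in> A\<close> \<open>y \<in> A\<close> disjnt_sym by blast
    qed
  qed
  ultimately have "homeomorphic_map (subtopology X A) Y id"
    using comp topY AT by (intro continuous_imp_homeomorphic_map) auto
  then show ?thesis
    using wo unfolding homeomorphic_to_ordinal_def Y_def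
    by (blast intro: homeomorphic_map_imp_homeomorphic_space)
qed

lemma paracompact_imp_direct_sum:
  assumes para: "paracompact_space X" and br: "\<And>B. is_branch T B \<Longrightarrow> countable B"
  shows "\<exists>P. top_direct_sum_of X P \<and> (\<forall>A\<in>P. countable A \<and> compact_space (subtopology X A)
                        \<and> homeomorphic_to_ordinal (subtopology X A))"
proof -
  have op_below: "openin X U" if "U \<in> below ` T" for U using that openin_below by auto
  have cov_below: "\<Union>(below ` T) = topspace X" by (auto simp: below_def)
  obtain \<V> where V: "\<forall>V\<in>\<V>. openin X V" "\<Union>\<V> = T" 
      "\<forall>V\<in>\<V>. \<exists>U\<in>below ` T. V \<subseteq> U" "locally_finite_in X \<V>"
    using paracompact_space_refinement[OF para op_below cov_below] unfolding topspace_X by blast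
  have cntV: "countable V" if "V \<in> \<V>" for V
    using V(3) that countable_below[OF br] countable_subset by blast
  have pt: "countable {V \<in> \<V>. x \<in> V}" if "x \<in> T" for x
  proof -
    obtain N where N: "x \<in> N" "finite {V \<in> \<V>. V \<inter> N \<noteq> {}}"
      using V(4) \<open>x \<in> T\<close> unfolding locally_finite_in_def topspace_X by meson
    have "{V \<in> \<V>. x \<in> V} \<subseteq> {V \<in> \<V>. V \<inter> N \<noteq> {}}" using N by auto
    then show ?thesis using N(2) finite_subset countable_finite by blast
  qed
  obtain S where S: "top_direct_sum_of X S" "\<And>K. K \<in> S \<Longrightarrow> countable K"
    using countable_open_partition[of \<V> X] V(1,2) cntV pt topspace_X by metis
  have S_un: "\<Union>S = T" and S_op: "\<And>K. K \<in> S \<Longrightarrow> openin X K"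
    and S_dj: "\<And>K L. K \<in> S \<Longrightarrow> L \<in> S \<Longrightarrow> K \<noteq> L \<Longrightarrow> K \<inter> L = {}"
    using S(1) by (simp_all add: top_direct_sum_of_def)
  have S_cl: "closedin X K" if "K \<in> S" for K
  proof -
    have "T - K = \<Union>(S - {K})" using S_un S_dj that by blast
    moreover have "openin X (\<Union>(S - {K}))" using S_op by blast
    ultimately show ?thesis using S_un that by (auto simp: closedin_def)
  qed
  \<comment> \<open>For finite \<open>K\<close> the enumeration repeats a value; a repeated value
    only produces an empty piece, which does no harm in \<open>P\<close>.\<close>
  define e where "e K n = from_nat_into K n" for K :: "'a set" and n :: nat
  \<comment> \<open>The intersection with \<open>K\<close> is essential: a class is open but may
    fail to be closed downwards, so \<open>below (e K n)\<close> can leave it.\<close>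
  define F where "F K n = K \<inter> below (e K n) - (\<Union>j<n. below (e K j))" for K n
  \<comment> \<open>An empty class is left out because its enumeration has unspecified values,
    possibly outside the tree.\<close>
  define P where "P = (\<Union>K\<in>S. if K = {} then {} else range (F K))"
  have eT: "e K n \<in> T" if "K \<in> S" "K \<noteq> {}" for K n
    using from_nat_into[OF that(2), of n] that S_un by (auto simp: e_def)
  have F_op: "openin X (F K n)" if "K \<in> S" "K \<noteq> {}" for K n
    unfolding F_def using eT[OF that] S_op that
    by (intro openin_diff openin_Int openin_below closedin_Union) (auto intro: closedin_below)
  have F_cl: "closedin X (F K n)" if "K \<in> S" "K \<noteq> {}" for K n
    unfolding F_def using eT[OF that] S_cl that
    by (intro closedin_diff closedin_Int closedin_below openin_Union) (auto intro: openin_below)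
  have F_cover: "\<exists>n. x \<in> F K n" if "K \<in> S" "x \<in> K" for K x
  proof -
    have "\<exists>n. e K n = x" using from_nat_into_surj[OF S(2)[OF that(1)] that(2)] by (simp add: e_def)
    moreover have "x \<in> T" using that S_un by auto
    ultimately have ex: "\<exists>n. x \<in> below (e K n)" by (auto simp: below_def)
    define n where "n = (LEAST n. x \<in> below (e K n))"
    have "x \<in> below (e K n)" using ex unfolding n_def by (rule LeastI_ex)
    moreover have "x \<notin> below (e K j)" if "j < n" for j
      using that unfolding n_def by (rule not_less_Least)
    ultimately show ?thesis using that by (auto simp: F_def)
  qed
  have F_sub: "F K n \<subseteq> K" "F K n \<subseteq> below (e K n)" for K n by (auto simp: F_def)
  have F_dj: "F K m = F L n" if KL: "K \<in> S" "L \<in> S" and x: "x \<in> F K m" "x \<in> F L n" for K L m n x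
  proof -
    have "x \<in> K" "x \<in> L" using x F_sub by blast+
    then have "K = L" using S_dj[OF KL] by blast
    moreover have "\<not> m < n" "\<not> n < m" using x \<open>K = L\<close> by (auto simp: F_def)
    ultimately show ?thesis by (simp add: linorder_neq_iff)
  qed
  have P_cases: "\<exists>K n. K \<in> S \<and> K \<noteq> {} \<and> A = F K n" if "A \<in> P" for A
    using that by (auto simp: P_def split: if_splits)
  have "\<Union>P = T"
  proof
    show "\<Union>P \<subseteq> T" using P_cases F_sub(1) S_un by blast
    show "T \<subseteq> \<Union>P"
    proof
      fix x assume "x \<in> T"
      then obtain K where K: "K \<in> S" "x \<in> K" using S_un by blast
      then obtain n where "x \<in> F K n" using F_cover by blast
      moreover have "F K n \<in> P" using K by (auto simp: P_def)
      ultimately show "x \<in> \<Union>P" by blast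
    qed
  qed
  moreover have "openin X A" if "A \<in> P" for A using P_cases[OF that] F_op by blast
  moreover have "A \<inter> B = {}" if AB: "A \<in> P" "B \<in> P" "A \<noteq> B" for A B
  proof (rule ccontr)
    assume "A \<inter> B \<noteq> {}"
    then obtain x where x: "x \<in> A" "x \<in> B" by blast
    obtain K m where K: "K \<in> S" "A = F K m" using P_cases[OF AB(1)] by blast
    obtain L n where L: "L \<in> S" "B = F L n" using P_cases[OF AB(2)] by blast
    show False using F_dj[OF K(1) L(1), of x m n] x K L AB(3) by simp
  qed
  ultimately have "top_direct_sum_of X P" by (simp add: top_direct_sum_of_def)
  moreover have "countable A \<and> compact_space (subtopology X A) \<and> homeomorphic_to_ordinal (subtopology X A)"
    if A: "A \<in> P" for A
  proof -
    obtain K n where K: "K \<in> S" "K \<noteq> {}" "A = F K n" using P_cases[OF A] by blast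
    have "compactin X A"
      using closed_compactin[OF compactin_below[OF eT[OF K(1,2)]] F_sub(2) F_cl[OF K(1,2)]] K(3) by simp
    then have "compact_space (subtopology X A)" by (rule compact_space_subtopology)
    moreover have "countable A" using countable_subset[OF F_sub(1) S(2)[OF K(1)]] K(3) by simp
    moreover have "A \<subseteq> below (e K n)" using F_sub(2) K(3) by simp
    ultimately show ?thesis using homeomorphic_to_ordinal_compact_chain eT[OF K(1,2)] by blast
  qed
  ultimately show ?thesis by blast
qed

text \<open>Within a piece, the traces of \<open>below t\<close> for \<open>t\<close> in the piece
  form a countable clopen family. It separates points by antisymmetry: if x \<le> y fails,
  \<open>below y\<close> contains \<open>y\<close> but not \<open>x\<close>.\<close>

lemma direct_sum_imp_metrizable:
  assumes P: "top_direct_sum_of X P"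
    and A: "\<And>A. A \<in> P \<Longrightarrow> countable A \<and> compact_space (subtopology X A)"
  shows "metrizable_space X"
proof (rule metrizable_space_direct_sum[OF P])
  fix A assume "A \<in> P"
  then have cnt: "countable A" and comp: "compact_space (subtopology X A)" and AT: "A \<subseteq> T"
    using A P by (auto simp: top_direct_sum_of_def)
  show "metrizable_space (subtopology X A)"
  proof (rule metrizable_space_compact_countable_clopen_separation[OF comp cnt])
    fix t assume "t \<in> A"
    then show "openin (subtopology X A) (A \<inter> below t) \<and> closedin (subtopology X A) (A \<inter> below t)"
      using openin_below closedin_below AT by (auto simp: openin_subtopology_Int2 closedin_subtopology)
  next
    fix x y assume "x \<in> topspace (subtopology X A)" "y \<in> topspace (subtopology X A)" "x \<noteq> y"
    then have xy: "x \<in> A" "y \<in> A" "x \<in> T" "y \<in> T" and "\<not> (x \<le> y \<and> y \<le> x)" by auto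
    then consider "\<not> x \<le> y" | "\<not> y \<le> x" by argo
    then show "\<exists>t\<in>A. (x \<in> A \<inter> below t) \<noteq> (y \<in> A \<inter> below t)"
    proof cases
      case 1 then show ?thesis using xy by (intro bexI[of _ y]) (simp_all add: below_def)
    next
      case 2 then show ?thesis using xy by (intro bexI[of _ x]) (simp_all add: below_def)
    qed
  qed
qed

end

theorem theorem4p8:
  fixes T :: "'a::order set"
  assumes "is_tree T"
    and "psup_singleton T"
    and "nontrivial_psups_are_sups T"
  shows "(hereditarily_paracompact (interval_topology T)
          \<longleftrightarrow> paracompact_space (interval_topology T) \<and> (\<forall>B. is_branch T B \<longrightarrow> countable B))
       \<and> (paracompact_space (interval_topology T) \<and> (\<forall>B. is_branch T B \<longrightarrow> countable B)
          \<longleftrightarrow> (\<exists>P. top_direct_sum_of (interval_topology T) P \<and>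
                 (\<forall>A\<in>P. countable A \<and> compact_space (subtopology (interval_topology T) A)
                        \<and> homeomorphic_to_ordinal (subtopology (interval_topology T) A))))
       \<and> ((\<exists>P. top_direct_sum_of (interval_topology T) P \<and>
                 (\<forall>A\<in>P. countable A \<and> compact_space (subtopology (interval_topology T) A)
                        \<and> homeomorphic_to_ordinal (subtopology (interval_topology T) A)))
          \<longleftrightarrow> metrizable_space (interval_topology T))"
proof -
  interpret hausdorff_tree T
    using assms by unfold_locales
  let ?P = "\<exists>P. top_direct_sum_of X P \<and> (\<forall>A\<in>P. countable A \<and> compact_space (subtopology X A)
               \<and> homeomorphic_to_ordinal (subtopology X A))"
  have "paracompact_space X \<and> (\<forall>B. is_branch T B \<longrightarrow> countable B)" if H: "hereditarily_paracompact X"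
  proof
    have "paracompact_space (subtopology X (topspace X))"
      using H unfolding hereditarily_paracompact_def by blast
    then show "paracompact_space X" by (simp only: subtopology_topspace)
    show "\<forall>B. is_branch T B \<longrightarrow> countable B"
      using hereditarily_paracompact_imp_countable_branch[OF H] by blast
  qed
  moreover have ?P if "paracompact_space X \<and> (\<forall>B. is_branch T B \<longrightarrow> countable B)"
    by (rule paracompact_imp_direct_sum) (use that in simp_all)
  moreover have "metrizable_space X" if ex: ?P
  proof -
    obtain P where P: "top_direct_sum_of X P"
      "\<forall>A\<in>P. countable A \<and> compact_space (subtopology X A) \<and> homeomorphic_to_ordinal (subtopology X A)"
      using ex by (elim exE conjE)
    show ?thesis by (rule direct_sum_imp_metrizable[OF P(1)]) (use P(2) in simp)
  qed
  moreover have "metrizable_space X \<Longrightarrow> hereditarily_paracompact X"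
    by (rule metrizable_imp_hereditarily_paracompact)
  ultimately show ?thesis by argo
qed

end
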